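(* There exists a semigroup $S$ for which $\sim_p$ is not transitive while, for every $a\in S$, the relation $\sim_p$ is transitive on the variant of $S$ at $a$.
   Context: For a semigroup $S$ and $x,y\in S$, $x\sim_p y$ iff there exist $u,v\in S$ such that $x=uv$ and $y=vu$. The variant of a semigroup $(S,\cdot)$ at $a\in S$ is the semigroup $(S,\circ)$ with $x\circ y:=x\cdot a\cdot y$ for all $x,y\in S$; the relation $\sim_p$ on the variant is computed with respect to the product $\circ$. *)

theory Defs
  imports Main
begin

text \<open>
  The locale \<open>semigroup\<close> of the library is type-based; here the underlying set is an
  explicit carrier, so that finite semigroups over an infinite type are covered.
  The values of the operation outside the carrier are irrelevant.
\<close>

locale semigroup_on =
  fixes S :: "'a set" and mult :: "'a \<Rightarrow> 'a \<Rightarrow> 'a"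
  assumes closed: "x \<in> S \<Longrightarrow> y \<in> S \<Longrightarrow> mult x y \<in> S"
    and assoc: "x \<in> S \<Longrightarrow> y \<in> S \<Longrightarrow> z \<in> S \<Longrightarrow> mult (mult x y) z = mult x (mult y z)"

text \<open>
  The factors \<open>u\<close> and \<open>v\<close> range over \<open>S\<close> itself, with no identity adjoined, so the
  relation need not be reflexive.
\<close>

definition p_conj :: "'a set \<Rightarrow> ('a \<Rightarrow> 'a \<Rightarrow> 'a) \<Rightarrow> 'a \<Rightarrow> 'a \<Rightarrow> bool" where
  "p_conj S mult x y \<longleftrightarrow> (\<exists>u\<in>S. \<exists>v\<in>S. x = mult u v \<and> y = mult v u)"

definition variant :: "('a \<Rightarrow> 'a \<Rightarrow> 'a) \<Rightarrow> 'a \<Rightarrow> 'a \<Rightarrow> 'a \<Rightarrow> 'a" where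
  "variant mult a x y = mult (mult x a) y"

lemma (in semigroup_on) semigroup_on_variant:
  assumes "a \<in> S"
  shows "semigroup_on S (variant mult a)"
  using assms by unfold_locales (simp_all add: variant_def closed assoc)

end

theory Submission
  imports Defs
begin

text \<open>
  If every product of three elements of \<open>S\<close> equals one fixed element \<open>0\<close>, then every variant
  of \<open>S\<close> has constant multiplication, so its conjugacy relation holds at most between \<open>0\<close> and
  itself and is transitive (lemma \<open>transp_on_p_conj_variant\<close>). Such a \<open>3\<close>-nilpotent semigroup
  may still have any prescribed products of two generators, as long as these products annihilate
  everything. Take generators \<open>1, 2, 3, 4\<close> with
  \<open>1 \<cdot> 2 = 5\<close>, \<open>2 \<cdot> 1 = 6 = 3 \<cdot> 4\<close>, \<open>4 \<cdot> 3 = 7\<close>, all other products being \<open>0\<close>. Then \<open>5\<close>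
  is conjugate to \<open>6\<close> and \<open>6\<close> to \<open>7\<close>, but the only factorization of \<open>5\<close> is \<open>1 \<cdot> 2\<close>,
  so \<open>5\<close> is not conjugate to \<open>7\<close>.
\<close>

lemma transp_on_p_conj_variant:
  assumes "\<And>x y. x \<in> S \<Longrightarrow> y \<in> S \<Longrightarrow> mult (mult x a) y = z"
  shows "transp_on S (p_conj S (variant mult a))"
  using assms by (auto simp: transp_on_def p_conj_def variant_def)

definition nil_mult :: "nat \<Rightarrow> nat \<Rightarrow> nat" where
  "nil_mult x y =
    (if (x, y) = (1, 2) then 5
     else if (x, y) \<in> {(2, 1), (3, 4)} then 6
     else if (x, y) = (4, 3) then 7
     else 0)"

lemma nil_mult_triple:
  "nil_mult (nil_mult x y) z = 0"
  "nil_mult x (nil_mult y z) = 0"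
  by (auto simp: nil_mult_def)

lemma not_transp_on_p_conj_nil_mult:
  "\<not> transp_on {..7} (p_conj {..7} nil_mult)"
proof
  assume trans: "transp_on {..7} (p_conj {..7} nil_mult)"
  have "p_conj {..7} nil_mult 5 6"
    unfolding p_conj_def
    by (rule bexI[of _ 1], rule bexI[of _ 2]) (simp_all add: nil_mult_def)
  moreover have "p_conj {..7} nil_mult 6 7"
    unfolding p_conj_def
    by (rule bexI[of _ 3], rule bexI[of _ 4]) (simp_all add: nil_mult_def)
  ultimately have "p_conj {..7} nil_mult 5 7"
    by (rule transp_onD[OF trans, rotated 3]) simp_all
  then show False
    by (auto simp: p_conj_def nil_mult_def split: if_splits)
qed

theorem mainTheorem5:
  shows "\<exists>(S :: nat set) mult.
    semigroup_on S mult \<and>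
    \<not> transp_on S (p_conj S mult) \<and>
    (\<forall>a\<in>S. transp_on S (p_conj S (variant mult a)))"
proof (intro exI conjI ballI)
  show "semigroup_on {..7} nil_mult"
    by unfold_locales (simp add: nil_mult_def, simp add: nil_mult_triple)
  show "\<not> transp_on {..7} (p_conj {..7} nil_mult)"
    by (fact not_transp_on_p_conj_nil_mult)
  show "transp_on {..7} (p_conj {..7} (variant nil_mult a))" for a
    by (rule transp_on_p_conj_variant) (rule nil_mult_triple)
qed

end
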